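(* Let $S$ be a Hausdorff topological semigroup whose square $S\times S$ is countably compact. Then: (i) each maximal subgroup $H(e)$, $e\in E(S)$, of $S$ (with the subspace topology) is a countably compact topological group; (ii) the subset $H(S)$ of $S$ is countably compact (in the subspace topology).
   Context: A topological semigroup is a topological space with a continuous associative binary operation. A space $X$ is countably compact if every countable open cover of $X$ has a finite subcover. $E(S)$ denotes the set of idempotents of a semigroup $S$; for $e\in E(S)$, $H(e)$ is the maximal subgroup of $S$ with identity $e$; $H(S)=\bigcup_{e\in E(S)}H(e)$. A topological group is a group with a topology making both multiplication and inversion continuous. *)

theory Defs
  imports "HOL-Analysis.Analysis" "HOL-Algebra.Group"
begin

definition idempotents :: "'a::semigroup_mult set"
  where "idempotents = {e. e * e = e}"

definition restrict_mult :: "'a::semigroup_mult set \<Rightarrow> 'a \<Rightarrow> 'a monoid"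
  where "restrict_mult A e = \<lparr>carrier = A, monoid.mult = (*), one = e\<rparr>"

definition maximal_subgroup :: "'a::semigroup_mult \<Rightarrow> 'a set"
  where "maximal_subgroup e = (GREATEST A. Group.group (restrict_mult A e))"

text \<open>For idempotent \<open>e\<close> the greatest subgroup with identity \<open>e\<close> exists,
  so that the use of \<open>GREATEST\<close> above is well-defined.\<close>

lemma greatest_subgroup_exists:
  fixes e :: "'a::semigroup_mult"
  assumes "e \<in> idempotents"
  shows "\<exists>H. Group.group (restrict_mult H e) \<and>
             (\<forall>A. Group.group (restrict_mult A e) \<longrightarrow> A \<subseteq> H)"
proof -
  define H where "H = {x. e * x = x \<and> x * e = x \<and>
    (\<exists>y. e * y = y \<and> y * e = y \<and> x * y = e \<and> y * x = e)}"
  have ee: "e * e = e" using assms by (simp add: idempotents_def)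
  have closed: "x * y \<in> H" if "x \<in> H" "y \<in> H" for x y
  proof -
    obtain x' where x': "e * x' = x'" "x' * e = x'" "x * x' = e" "x' * x = e"
      using \<open>x \<in> H\<close> by (auto simp: H_def)
    obtain y' where y': "e * y' = y'" "y' * e = y'" "y * y' = e" "y' * y = e"
      using \<open>y \<in> H\<close> by (auto simp: H_def)
    have xy: "e * x = x" "x * e = x" "e * y = y" "y * e = y"
      using that by (auto simp: H_def)
    have "(x * y) * (y' * x') = x * (y * y') * x'" by (simp only: mult.assoc)
    then have 1: "(x * y) * (y' * x') = e" using x' y' xy by simp
    have "(y' * x') * (x * y) = y' * (x' * x) * y" by (simp only: mult.assoc)
    then have 2: "(y' * x') * (x * y) = e" using x' y' xy by simp
    have 3: "e * (y' * x') = y' * x'" "(y' * x') * e = y' * x'"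
      by (simp add: mult.assoc[symmetric] y', simp add: mult.assoc x')
    have 4: "e * (x * y) = x * y" "(x * y) * e = x * y"
      by (simp add: mult.assoc[symmetric] xy, simp add: mult.assoc xy)
    show ?thesis unfolding H_def using 1 2 3 4 by blast
  qed
  have "Group.group (restrict_mult H e)"
  proof (rule groupI)
    show "\<exists>y\<in>carrier (restrict_mult H e).
        y \<otimes>\<^bsub>restrict_mult H e\<^esub> x = \<one>\<^bsub>restrict_mult H e\<^esub>"
      if "x \<in> carrier (restrict_mult H e)" for x
      using that by (auto simp: restrict_mult_def H_def)
  qed (use closed ee in \<open>auto simp: restrict_mult_def H_def mult.assoc\<close>)
  moreover have "A \<subseteq> H" if "Group.group (restrict_mult A e)" for A
  proof
    fix x assume "x \<in> A"
    interpret G: Group.group "restrict_mult A e" by (fact that)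
    have x: "x \<in> carrier (restrict_mult A e)" using \<open>x \<in> A\<close> by (simp add: restrict_mult_def)
    have y: "inv\<^bsub>restrict_mult A e\<^esub> x \<in> carrier (restrict_mult A e)" using x by simp
    show "x \<in> H"
      using G.l_one[OF x] G.r_one[OF x] G.l_one[OF y] G.r_one[OF y] G.l_inv[OF x] G.r_inv[OF x]
      by (auto simp: restrict_mult_def H_def)
  qed
  ultimately show ?thesis by blast
qed

definition subgroups_union :: "'a::semigroup_mult set"
  where "subgroups_union = (\<Union>e\<in>idempotents. maximal_subgroup e)"

definition topological_group :: "('a, 'b) monoid_scheme \<Rightarrow> 'a topology \<Rightarrow> bool"
  where "topological_group G T \<longleftrightarrow>
    Group.group G \<and> topspace T = carrier G \<and>
    continuous_map (prod_topology T T) T (\<lambda>(x, y). x \<otimes>\<^bsub>G\<^esub> y) \<and>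
    continuous_map T T (\<lambda>x. inv\<^bsub>G\<^esub> x)"

end

theory Submission
  imports Defs
begin

text \<open>
  An element \<open>x\<close> lies in \<open>H(e)\<close> iff it has a partner \<open>y\<close> with \<open>x y = y x = e\<close> and \<open>e\<close> acting trivially
  on both, and it lies in \<open>H(S)\<close> iff it has a partner with \<open>x y = y x\<close>, \<open>x y x = x\<close>, \<open>y x y = y\<close>.
  Both conditions define closed subsets of \<open>S \<times> S\<close>, so \<open>H(e)\<close> and \<open>H(S)\<close> are projections of countably
  compact sets.

  If inversion on \<open>H(e)\<close> were discontinuous at \<open>e\<close>, there would be neighbourhoods \<open>U\<^sub>n\<close> of \<open>e\<close> with
  \<open>U\<^sub>n\<^sub>+\<^sub>1 U\<^sub>n\<^sub>+\<^sub>1 \<subseteq> U\<^sub>n\<close> and elements \<open>x\<^sub>n \<in> U\<^sub>n\<^sub>+\<^sub>1\<close> with inverse outside \<open>U\<^sub>0\<close>. Put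
  \<open>p\<^sub>n = x\<^sub>0 \<cdots> x\<^sub>n\<^sub>-\<^sub>1\<close>. Since the pairs of \<open>p\<^sub>n\<close> and its inverse cluster in \<open>S \<times> S\<close>, there are \<open>n < m\<close>
  such that (inverse of \<open>p\<^sub>m\<close>) \<open>p\<^sub>n\<close> lies in \<open>U\<^sub>1\<close>. The inverse of \<open>x\<^sub>n\<close> is the product of
  \<open>x\<^sub>n\<^sub>+\<^sub>1 \<cdots> x\<^sub>m\<^sub>-\<^sub>1 \<in> U\<^sub>1\<close> with this element, so it is in \<open>U\<^sub>0\<close>, a contradiction.
\<close>

section \<open>Countable compactness\<close>

lemma countably_compact_Int_closed:
  assumes "countably_compact K" "closed C"
  shows "countably_compact (K \<inter> C)"
proof (rule countably_compactI)
  fix A assume A: "\<forall>a\<in>A. open a" "K \<inter> C \<subseteq> \<Union>A" "countable A"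
  obtain B where B: "B \<subseteq> insert (- C) A" "finite B" "K \<subseteq> \<Union>B"
  proof (rule countably_compactE[OF assms(1)])
    show "\<forall>t\<in>insert (- C) A. open t" "K \<subseteq> \<Union>(insert (- C) A)" "countable (insert (- C) A)"
      using A assms(2) by auto
  qed
  have "B - {- C} \<subseteq> A" "finite (B - {- C})" "K \<inter> C \<subseteq> \<Union>(B - {- C})"
    using B by auto
  then show "\<exists>T\<subseteq>A. finite T \<and> K \<inter> C \<subseteq> \<Union>T" by blast
qed

lemma countably_compact_continuous_image:
  assumes "continuous_on UNIV f" "countably_compact K"
  shows "countably_compact (f ` K)"
proof (rule countably_compactI)
  fix A assume A: "\<forall>a\<in>A. open a" "f ` K \<subseteq> \<Union>A" "countable A"
  obtain B where B: "B \<subseteq> (\<lambda>a. f -` a) ` A" "finite B" "K \<subseteq> \<Union>B"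
  proof (rule countably_compactE[OF assms(2)])
    show "\<forall>t\<in>(\<lambda>a. f -` a) ` A. open t"
      using A(1) assms(1) by (auto intro: open_vimage)
    show "K \<subseteq> \<Union>((\<lambda>a. f -` a) ` A)" using A(2) by blast
    show "countable ((\<lambda>a. f -` a) ` A)" using A(3) by simp
  qed
  obtain T where T: "T \<subseteq> A" "finite T" "B = (\<lambda>a. f -` a) ` T"
    using finite_subset_image[OF B(2,1)] by blast
  then have "f ` K \<subseteq> \<Union>T" using B(3) by auto
  then show "\<exists>T\<subseteq>A. finite T \<and> f ` K \<subseteq> \<Union>T" using T by blast
qed

text \<open>Without a cluster point, the complements of the closures of the tails of
  \<open>f\<close> form a countable open cover. In a finite subcover the indices are bounded by some
  \<open>k\<close>, and then \<open>f k\<close> is left uncovered.\<close>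

lemma countably_compact_UNIV_cluster_point:
  fixes f :: "nat \<Rightarrow> 'a::topological_space"
  assumes "countably_compact (UNIV :: 'a set)"
  shows "\<exists>z. \<forall>V N. open V \<longrightarrow> z \<in> V \<longrightarrow> (\<exists>n\<ge>N. f n \<in> V)"
proof (rule ccontr)
  assume "\<not> ?thesis"
  then have no: "\<exists>V N. open V \<and> z \<in> V \<and> (\<forall>n\<ge>N. f n \<notin> V)" for z by simp
  \<comment> \<open>Sorting the avoiding neighbourhoods by the index \<open>N\<close> makes the
    cover countable, however many points there are.\<close>
  define D where "D N = \<Union>{V. open V \<and> (\<forall>n\<ge>N. f n \<notin> V)}" for N
  obtain B where B: "B \<subseteq> range D" "finite B" "UNIV \<subseteq> \<Union>B"
  proof (rule countably_compactE[OF assms])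
    show "\<forall>t\<in>range D. open t" by (auto simp: D_def)
    show "UNIV \<subseteq> \<Union>(range D)"
    proof
      fix z
      obtain V N where "open V" "z \<in> V" "\<forall>n\<ge>N. f n \<notin> V" using no[of z] by blast
      then have "z \<in> D N" by (auto simp: D_def)
      then show "z \<in> \<Union>(range D)" by blast
    qed
    show "countable (range D)" by simp
  qed
  obtain M where M: "finite M" "B = D ` M"
    using finite_subset_image[OF B(2,1)] by blast
  obtain k where k: "\<forall>i\<in>M. i \<le> k" using M(1) finite_nat_set_iff_bounded_le by blast
  obtain i where "i \<in> M" "f k \<in> D i" using B(3) M(2) by blast
  then show False using k unfolding D_def by blast
qed

section \<open>Maximal subgroups\<close>

text \<open>Being mutually inverse in the maximal subgroup at \<open>e\<close>, expressed by
  equations alone so that closedness in the square can be read off.\<close>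

definition group_inverses :: "'a::semigroup_mult \<Rightarrow> 'a \<Rightarrow> 'a \<Rightarrow> bool"
  where "group_inverses e x y \<longleftrightarrow>
    e * x = x \<and> x * e = x \<and> e * y = y \<and> y * e = y \<and> x * y = e \<and> y * x = e"

lemma group_inverses_sym: "group_inverses e x y \<Longrightarrow> group_inverses e y x"
  by (auto simp: group_inverses_def)

lemma group_inverses_cancel:
  assumes "group_inverses e x y"
  shows "x * (y * z) = e * z" "y * (x * z) = e * z"
  using assms by (auto simp: group_inverses_def mult.assoc[symmetric])

lemma group_inverses_unit:
  assumes "group_inverses e x y"
  shows "e * x = x" "x * e = x" "e * y = y" "y * e = y" "x * y = e" "y * x = e"
    "e * (x * z) = x * z" "e * (y * z) = y * z" "x * (e * z) = x * z" "y * (e * z) = y * z"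
  using assms by (auto simp: group_inverses_def mult.assoc[symmetric])

lemma group_inverses_mult:
  assumes "group_inverses e x y" "group_inverses e x' y'"
  shows "group_inverses e (x * x') (y' * y)"
  unfolding group_inverses_def
  by (simp add: mult.assoc group_inverses_cancel[OF assms(1)] group_inverses_cancel[OF assms(2)]
      group_inverses_unit[OF assms(1)] group_inverses_unit[OF assms(2)])

lemma group_maximal_subgroup:
  assumes "e \<in> idempotents"
  shows "Group.group (restrict_mult (maximal_subgroup e) e)"
    and "Group.group (restrict_mult A e) \<Longrightarrow> A \<subseteq> maximal_subgroup e"
proof -
  obtain H where H: "Group.group (restrict_mult H e)"
      "\<forall>A. Group.group (restrict_mult A e) \<longrightarrow> A \<subseteq> H"
    using greatest_subgroup_exists[OF assms] by blast
  have "maximal_subgroup e = H"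
    unfolding maximal_subgroup_def using H by (intro Greatest_equality) auto
  then show "Group.group (restrict_mult (maximal_subgroup e) e)"
    and "Group.group (restrict_mult A e) \<Longrightarrow> A \<subseteq> maximal_subgroup e"
    using H by auto
qed

lemma group_inverses_inv:
  assumes "Group.group (restrict_mult A e)" "x \<in> A"
  shows "group_inverses e x (inv\<^bsub>restrict_mult A e\<^esub> x)"
    and "inv\<^bsub>restrict_mult A e\<^esub> x \<in> A"
proof -
  interpret Group.group "restrict_mult A e" by (fact assms(1))
  have x: "x \<in> carrier (restrict_mult A e)" using assms(2) by (simp add: restrict_mult_def)
  note y = inv_closed[OF x]
  show "group_inverses e x (inv\<^bsub>restrict_mult A e\<^esub> x)"
    using l_one[OF x] r_one[OF x] l_one[OF y] r_one[OF y] l_inv[OF x] r_inv[OF x]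
    by (auto simp: restrict_mult_def group_inverses_def)
  show "inv\<^bsub>restrict_mult A e\<^esub> x \<in> A" using y by (simp add: restrict_mult_def)
qed

text \<open>An inverse in the group serves as partner. Conversely, the elements with a partner form
  a group with identity \<open>e\<close>, which maximality places inside
  \<open>maximal_subgroup e\<close>.\<close>

lemma mem_maximal_subgroup_iff:
  assumes e: "e \<in> idempotents"
  shows "x \<in> maximal_subgroup e \<longleftrightarrow> (\<exists>y. group_inverses e x y)"
proof
  assume "x \<in> maximal_subgroup e"
  then show "\<exists>y. group_inverses e x y"
    using group_inverses_inv(1)[OF group_maximal_subgroup(1)[OF e]] by blast
next
  assume "\<exists>y. group_inverses e x y"
  moreover have "Group.group (restrict_mult {x. \<exists>y. group_inverses e x y} e)"
  proof (rule groupI)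
    show "\<one>\<^bsub>restrict_mult {x. \<exists>y. group_inverses e x y} e\<^esub>
        \<in> carrier (restrict_mult {x. \<exists>y. group_inverses e x y} e)"
      using e by (auto simp: restrict_mult_def group_inverses_def idempotents_def)
  qed (auto simp: restrict_mult_def mult.assoc group_inverses_unit
      intro: group_inverses_mult dest: group_inverses_sym group_inverses_unit(6))
  ultimately show "x \<in> maximal_subgroup e"
    using group_maximal_subgroup(2)[OF e] by blast
qed

lemma maximal_subgroup_eq_fst_image:
  "e \<in> idempotents \<Longrightarrow> maximal_subgroup e = fst ` {(x, y). group_inverses e x y}"
  by (force simp: mem_maximal_subgroup_iff)

text \<open>The identity can be eliminated: it is recovered as \<open>e = x * y\<close>, which the
  three equations make idempotent and neutral for \<open>x\<close> and \<open>y\<close>. What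
  remains is a single closed condition instead of a union over all idempotents.\<close>

lemma subgroups_union_eq_fst_image:
  "subgroups_union = fst ` {(x, y). x * y = y * x \<and> x * y * x = x \<and> y * x * y = y}"
proof -
  have "(\<exists>e\<in>idempotents. \<exists>y. group_inverses e x y) \<longleftrightarrow>
      (\<exists>y. x * y = y * x \<and> x * y * x = x \<and> y * x * y = y)" for x :: 'a
  proof
    assume "\<exists>y. x * y = y * x \<and> x * y * x = x \<and> y * x * y = y"
    then obtain y where y: "x * y = y * x" "x * y * x = x" "y * x * y = y" by blast
    have "x * y \<in> idempotents" using y by (simp add: idempotents_def mult.assoc[symmetric])
    moreover have "group_inverses (x * y) x y"
      using y(2,3) mult.assoc[of x y x] mult.assoc[of y x y] y(1)
      by (simp add: group_inverses_def)
    ultimately show "\<exists>e\<in>idempotents. \<exists>y. group_inverses e x y" by blast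
  next
    assume "\<exists>e\<in>idempotents. \<exists>y. group_inverses e x y"
    then obtain e y where "group_inverses e x y" by blast
    then have "x * y = y * x \<and> x * y * x = x \<and> y * x * y = y"
      by (simp add: group_inverses_def)
    then show "\<exists>y. x * y = y * x \<and> x * y * x = x \<and> y * x * y = y" by blast
  qed
  then have "subgroups_union = {x::'a. \<exists>y. x * y = y * x \<and> x * y * x = x \<and> y * x * y = y}"
    unfolding subgroups_union_def by (simp add: set_eq_iff mem_maximal_subgroup_iff)
  also have "\<dots> = fst ` {(x, y). x * y = y * x \<and> x * y * x = x \<and> y * x * y = y}"
    unfolding image_def by simp
  finally show ?thesis .
qed

section \<open>Topology of the maximal subgroups\<close>

lemma continuous_on_semigroup_mult:
  fixes f g :: "'b::topological_space \<Rightarrow> 'a::topological_semigroup_mult"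
  assumes "continuous_on A f" "continuous_on A g"
  shows "continuous_on A (\<lambda>x. f x * g x)"
  using assms unfolding continuous_on_def by (auto intro: tendsto_mult)

lemmas semigroup_continuous_intros =
  continuous_on_semigroup_mult continuous_on_fst continuous_on_snd continuous_on_const continuous_on_id

lemma open_mult_nhds:
  fixes a b :: "'a::topological_semigroup_mult"
  assumes "open U" "a * b \<in> U"
  obtains A B where "open A" "open B" "a \<in> A" "b \<in> B" "\<And>x y. x \<in> A \<Longrightarrow> y \<in> B \<Longrightarrow> x * y \<in> U"
proof -
  have "continuous_on UNIV (\<lambda>z::'a \<times> 'a. fst z * snd z)"
    by (intro semigroup_continuous_intros)
  then have "open ((\<lambda>z::'a \<times> 'a. fst z * snd z) -` U)"
    using assms(1) by (rule open_vimage[rotated])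
  moreover have "(a, b) \<in> (\<lambda>z. fst z * snd z) -` U" using assms(2) by simp
  ultimately obtain A B where "open A" "open B" "(a, b) \<in> A \<times> B"
      "A \<times> B \<subseteq> (\<lambda>z. fst z * snd z) -` U"
    by (rule open_prod_elim)
  then show thesis using that[of A B] by (fastforce simp: subset_iff)
qed

section \<open>Continuity of inversion\<close>

lemma square_nhds_sequence:
  fixes e :: "'a::topological_semigroup_mult"
  assumes "e * e = e" "open U" "e \<in> U"
  obtains V :: "nat \<Rightarrow> 'a set"
  where "V 0 = U" "\<And>n. open (V n)" "\<And>n. e \<in> V n"
    "decseq V" "\<And>n x y. x \<in> V (Suc n) \<Longrightarrow> y \<in> V (Suc n) \<Longrightarrow> x * y \<in> V n"
proof -
  \<comment> \<open>The clause on index 0 pins the first set to \<open>U\<close> in the dependent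
    choice.\<close>
  have "\<exists>W. (open W \<and> e \<in> W \<and> (Suc n = 0 \<longrightarrow> W = U)) \<and> W \<subseteq> X \<and> (\<forall>x\<in>W. \<forall>y\<in>W. x * y \<in> X)"
    if X: "open X \<and> e \<in> X \<and> (n = 0 \<longrightarrow> X = U)" for X and n :: nat
  proof -
    obtain A B where "open A" "open B" "e \<in> A" "e \<in> B" "\<And>x y. x \<in> A \<Longrightarrow> y \<in> B \<Longrightarrow> x * y \<in> X"
      using open_mult_nhds[of X e e] X assms(1) by auto
    then show ?thesis by (intro exI[of _ "A \<inter> B \<inter> X"]) (use X in auto)
  qed
  then obtain V where "\<forall>n. (open (V n) \<and> e \<in> V n \<and> (n = 0 \<longrightarrow> V n = U)) \<and>
      V (Suc n) \<subseteq> V n \<and> (\<forall>x\<in>V (Suc n). \<forall>y\<in>V (Suc n). x * y \<in> V n)"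
    using dependent_nat_choice[of "\<lambda>n X. open X \<and> e \<in> X \<and> (n = (0::nat) \<longrightarrow> X = U)"
        "\<lambda>n X W. W \<subseteq> X \<and> (\<forall>x\<in>W. \<forall>y\<in>W. x * y \<in> X)"] assms(2,3) by blast
  then show thesis using that[of V] decseq_SucI[of V] by blast
qed

lemma inverse_continuous_at_unit:
  fixes e :: "'a::{t2_space, topological_semigroup_mult}"
  assumes cc: "countably_compact (UNIV :: ('a \<times> 'a) set)"
    and e: "e * e = e" and U: "open U" "e \<in> U"
  shows "\<exists>W. open W \<and> e \<in> W \<and> (\<forall>x y. group_inverses e x y \<longrightarrow> x \<in> W \<longrightarrow> y \<in> U)"
proof (rule ccontr)
  assume "\<not> ?thesis"
  then have bad: "\<exists>x y. group_inverses e x y \<and> x \<in> W \<and> y \<notin> U" if "open W" "e \<in> W" for W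
    using that by simp
  obtain V where V: "V 0 = U" "\<And>n. open (V n)" "\<And>n. e \<in> V n" "decseq V"
    "\<And>n x y. x \<in> V (Suc n) \<Longrightarrow> y \<in> V (Suc n) \<Longrightarrow> x * y \<in> V n"
    using square_nhds_sequence[OF e U] by blast
  have "\<forall>n. \<exists>x y. group_inverses e x y \<and> x \<in> V (Suc n) \<and> y \<notin> U"
    using bad V by blast
  then obtain x y where xy: "\<And>n. group_inverses e (x n) (y n)" "\<And>n. x n \<in> V (Suc n)" "\<And>n. y n \<notin> U"
    by metis
  \<comment> \<open>Partial products of the \<open>x n\<close>, and their inverses with factors in
    reverse order.\<close>
  define p where "p = rec_nat e (\<lambda>n a. a * x n)"
  define q where "q = rec_nat e (\<lambda>n a. y n * a)"
  have p: "p 0 = e" "p (Suc n) = p n * x n" and q: "q 0 = e" "q (Suc n) = y n * q n" for n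
    by (simp_all add: p_def q_def)
  have pq: "group_inverses e (p n) (q n)" for n
    by (induction n) (use e xy(1) in \<open>auto simp: p q intro: group_inverses_mult,
        auto simp: group_inverses_def\<close>)
  \<comment> \<open>Here \<open>r\<close> is the product of \<open>x n\<close> up to
    \<open>x (n + k - 1)\<close>. By induction the factors after \<open>x n\<close> multiply into
    \<open>V (Suc n)\<close>, which also contains \<open>x n\<close>, so the whole product lies in
    \<open>V n\<close>.\<close>
  have tail: "\<exists>r. r \<in> V n \<and> e * r = r \<and> p (n + k) = p n * r" for n k
  proof (induction k arbitrary: n)
    case 0
    then show ?case using V(3) e group_inverses_unit(2)[OF pq] by (intro exI[of _ e]) auto
  next
    case (Suc k)
    obtain r where "r \<in> V (Suc n)" "e * r = r" "p (Suc n + k) = p (Suc n) * r" using Suc by blast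
    then have "x n * r \<in> V n" "e * (x n * r) = x n * r" "p (n + Suc k) = p n * (x n * r)"
      using V(5) xy(2) group_inverses_unit(7)[OF xy(1)] by (auto simp: p mult.assoc)
    then show ?case by blast
  qed
  obtain z where "\<forall>B N. open B \<longrightarrow> z \<in> B \<longrightarrow> (\<exists>n\<ge>N. (p n, q n) \<in> B)"
    using countably_compact_UNIV_cluster_point[OF cc, of "\<lambda>n. (p n, q n)"] ..
  then have z: "\<And>B N. open B \<Longrightarrow> z \<in> B \<Longrightarrow> \<exists>n\<ge>N. (p n, q n) \<in> B" by simp
  \<comment> \<open>The equation holds at every \<open>(p n, q n)\<close> and defines a closed set
    by the Hausdorff property, so it passes to the cluster point.\<close>
  have "snd z * fst z = e"
  proof (rule ccontr)
    assume "snd z * fst z \<noteq> e"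
    moreover have "open {w::'a \<times> 'a. snd w * fst w \<noteq> e}"
      by (intro open_Collect_neq semigroup_continuous_intros)
    ultimately obtain n where "q n * p n \<noteq> e" using z[of "{w. snd w * fst w \<noteq> e}"] by auto
    then show False using pq group_inverses_unit(6) by blast
  qed
  then obtain A B where AB: "open A" "open B" "snd z \<in> A" "fst z \<in> B"
      "\<And>a b. a \<in> A \<Longrightarrow> b \<in> B \<Longrightarrow> a * b \<in> V 1"
    using open_mult_nhds[of "V 1" "snd z" "fst z"] V(2,3) by metis
  have frequently: "\<exists>n\<ge>N. p n \<in> B \<and> q n \<in> A" for N
    using z[of "B \<times> A" N] AB by (auto simp: open_Times mem_Times_iff)
  obtain n where n: "p n \<in> B" using frequently[of 0] by blast
  obtain m where m: "m \<ge> Suc n" "q m \<in> A" using frequently[of "Suc n"] by blast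
  obtain r where r: "r \<in> V (Suc n)" "e * r = r" "p m = p (Suc n) * r"
    using tail[of "Suc n" "m - Suc n"] m(1) by auto
  \<comment> \<open>Cancelling \<open>p (Suc n)\<close> gives \<open>r = q (Suc n) * p m\<close>.
    Hence \<open>r * q m\<close> is \<open>q (Suc n)\<close>, that is \<open>y n * q n\<close>, and
    multiplying by \<open>p n\<close> on the right isolates \<open>y n\<close>.\<close>
  have "r * q m = q (Suc n) * (p m * q m)"
    using group_inverses_cancel(2)[OF pq[of "Suc n"], of "r * q m"] r(2,3)
    by (metis mult.assoc)
  also have "\<dots> = y n * q n"
    using pq[of m] pq[of "Suc n"] by (simp add: group_inverses_def q)
  finally have "r * q m * p n = y n * q n * p n" by simp
  then have "r * (q m * p n) = y n"
    using pq[of n] xy(1)[of n] by (simp add: group_inverses_def mult.assoc)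
  moreover have "r \<in> V 1" using r(1) decseqD[OF V(4), of 1 "Suc n"] by auto
  ultimately have "y n \<in> U" using V(1) V(5)[of r 0 "q m * p n"] AB(5) m(2) n by auto
  then show False using xy(3) by blast
qed

text \<open>Translation reduces continuity at \<open>x\<close> to continuity at \<open>e\<close>:
  for \<open>y\<close> near \<open>x\<close> the product \<open>i x * y\<close> is near
  \<open>e\<close>, hence so is its inverse \<open>i y * x\<close>, and
  \<open>i y = (i y * x) * i x\<close> is near \<open>i x\<close>.\<close>

lemma continuous_on_group_inverse:
  fixes e :: "'a::{t2_space, topological_semigroup_mult}"
  assumes cc: "countably_compact (UNIV :: ('a \<times> 'a) set)"
    and e: "e * e = e"
    and inv: "\<And>x. x \<in> A \<Longrightarrow> group_inverses e x (i x)"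
  shows "continuous_on A i"
  unfolding continuous_on_topological
proof (intro ballI allI impI)
  fix x B assume x: "x \<in> A" and B: "open B" "i x \<in> B"
  have "e * i x \<in> B" using B inv[OF x] by (simp add: group_inverses_def)
  then obtain U C where U: "open U" "e \<in> U" and C: "i x \<in> C"
      and UC: "\<And>u v. u \<in> U \<Longrightarrow> v \<in> C \<Longrightarrow> u * v \<in> B"
    using open_mult_nhds[OF B(1)] by metis
  obtain W where W: "open W" "e \<in> W" "\<And>x y. group_inverses e x y \<Longrightarrow> x \<in> W \<Longrightarrow> y \<in> U"
    using inverse_continuous_at_unit[OF cc e U] by blast
  have "continuous_on UNIV (\<lambda>y. i x * y)" by (intro semigroup_continuous_intros)
  then have "open ((\<lambda>y. i x * y) -` W)" using W(1) by (rule open_vimage[rotated])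
  moreover have "x \<in> (\<lambda>y. i x * y) -` W" using W(2) inv[OF x] by (simp add: group_inverses_def)
  moreover have "i y \<in> B" if y: "y \<in> A" "y \<in> (\<lambda>y. i x * y) -` W" for y
  proof -
    have "group_inverses e (i x * y) (i y * x)"
      using inv x y(1) by (intro group_inverses_mult group_inverses_sym[OF inv])
    then have "i y * x \<in> U" using W(3) y(2) by auto
    then have "i y * x * i x \<in> B" using UC C by blast
    then show ?thesis using inv[OF x] inv[OF y(1)] by (simp add: group_inverses_def mult.assoc)
  qed
  ultimately show "\<exists>T. open T \<and> x \<in> T \<and> (\<forall>y\<in>A. y \<in> T \<longrightarrow> i y \<in> B)" by blast
qed

lemma topological_group_restrict_mult:
  fixes e :: "'a::{t2_space, topological_semigroup_mult}"
  assumes cc: "countably_compact (UNIV :: ('a \<times> 'a) set)"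
    and G: "Group.group (restrict_mult A e)"
  shows "topological_group (restrict_mult A e) (top_of_set A)"
proof -
  interpret Group.group "restrict_mult A e" by (fact G)
  have "e * e = e" using l_one[OF one_closed] by (simp add: restrict_mult_def)
  then have "continuous_on A (\<lambda>x. inv\<^bsub>restrict_mult A e\<^esub> x)"
    using continuous_on_group_inverse[OF cc] group_inverses_inv(1)[OF G] by blast
  then have "continuous_map (top_of_set A) (top_of_set A) (\<lambda>x. inv\<^bsub>restrict_mult A e\<^esub> x)"
    using group_inverses_inv(2)[OF G] by auto
  moreover have "continuous_on (A \<times> A) (\<lambda>z. fst z * snd z)"
    by (intro semigroup_continuous_intros)
  then have "continuous_map (prod_topology (top_of_set A) (top_of_set A)) (top_of_set A) (\<lambda>(x, y). x * y)"
    using m_closed by (auto simp: subtopology_Times[symmetric] euclidean_product_topology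
        restrict_mult_def case_prod_unfold)
  ultimately show ?thesis
    using G by (simp add: topological_group_def restrict_mult_def)
qed

theorem theorem4:
  assumes "countably_compact (UNIV :: ('a \<times> 'a) set)"
  shows "(\<forall>e \<in> (idempotents :: 'a::{t2_space, topological_semigroup_mult} set).
            topological_group (restrict_mult (maximal_subgroup e) e)
              (top_of_set (maximal_subgroup e)) \<and>
            countably_compact (maximal_subgroup e)) \<and>
         countably_compact (subgroups_union :: 'a set)"
proof -
  have projection: "countably_compact (fst ` C)" if "closed C" for C :: "('a \<times> 'a) set"
    using countably_compact_continuous_image[OF continuous_on_fst[OF continuous_on_id]
        countably_compact_Int_closed[OF assms that]] by simp
  show ?thesis
  proof (intro conjI ballI)
    fix e :: 'a assume e: "e \<in> idempotents"
    show "topological_group (restrict_mult (maximal_subgroup e) e) (top_of_set (maximal_subgroup e))"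
      by (rule topological_group_restrict_mult[OF assms group_maximal_subgroup(1)[OF e]])
    \<comment> \<open>Each conjunct equates two continuous maps into a Hausdorff space.\<close>
    have "closed {(x, y). group_inverses e x y}"
      unfolding group_inverses_def case_prod_unfold
      by (intro closed_Collect_conj closed_Collect_eq semigroup_continuous_intros)
    then show "countably_compact (maximal_subgroup e)"
      unfolding maximal_subgroup_eq_fst_image[OF e] by (rule projection)
  next
    have "closed {(x :: 'a, y). x * y = y * x \<and> x * y * x = x \<and> y * x * y = y}"
      unfolding case_prod_unfold
      by (intro closed_Collect_conj closed_Collect_eq semigroup_continuous_intros)
    then show "countably_compact (subgroups_union :: 'a set)"
      unfolding subgroups_union_eq_fst_image by (rule projection)
  qed
qed

end
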